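(* Let $d\ge3$. There is a unique measure $\nu$ on $(W^*,\mathcal{W}^* )$ such that for every finite set $K\subset\mathsf{Z}^d$, $$1_{W_K^*}\,\nu=Q_K\pi^{-1},$$ where $Q_K\pi^{-1}$ denotes the image measure of $Q_K$ under $\pi:W\to W^*$.
   Context: $\mathsf{N}=\{0,1,2,\dots\}$. Let $J=\{(a,1):a\in\mathsf{Z}^{d-1},|a|_1=1\}\subset\mathsf{Z}^d$ be the set of upward jumps. Define $W=\{w:\mathsf{Z}\to\mathsf{Z}^d : w(n+1)-w(n)\in J \text{ for all } n\in\mathsf{Z}\}$ and $W_\pm=\{w:\mathsf{N}\to\mathsf{Z}^d: \pm(w(n+1)-w(n))\in J\text{ for all }n\in\mathsf{N}\}$, endowed with the $\sigma$-algebras $\mathcal{W}$, $\mathcal{W}_\pm$ generated by the coordinate maps $X_n$. $P_x^+$ is the law on $W_+$ of the Markov chain started at $x\in\mathsf{Z}^d$ whose steps are i.i.d. uniform on $J$ (each $e\in J$ has probability $\frac1{2(d-1)}$); $P_x^-$ is the law on $W_-$ of the chain started at $x$ whose steps are i.i.d. uniform on $-J$. For paths indexed by $\mathsf{N}$, $\widetilde H_K=\inf\{n\ge1:X_n\in K\}$. For $w\in W$, $H_K(w)=\inf\{n\in\mathsf{Z}:X_n(w)\in K\}$; $W_K^n=\{w\in W:H_K(w)=n\}$ and $W_K=\bigcup_{n\in\mathsf{Z}}W_K^n$. Two paths $w,w'\in W$ are equivalent if $w(\cdot)=w'(k+\cdot)$ for some $k\in\mathsf{Z}$; $W^*$ is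 the quotient set, $\pi:W\to W^*$ the canonical projection, $\mathcal{W}^*=\{A\subset W^*:\pi^{-1}(A)\in\mathcal{W}\}$, and $W_K^*=\pi(W_K)$. For finite $K\subset\mathsf{Z}^d$, $Q_K$ is the measure on $(W,\mathcal{W})$, supported on $W_K^0$ (in particular giving no mass to $\{X_0\notin K\}$), determined by $$Q_K\big[(X_{-n})_{n\ge0}\in A,\ X_0=x,\ (X_n)_{n\ge0}\in B\big]=P_x^-\big(A\cap\{\widetilde H_K=\infty\}\big)\,P_x^+(B)$$ for all $A\in\mathcal{W}_-$, $B\in\mathcal{W}_+$, $x\in K$. *)

theory Defs
  imports "HOL-Probability.Probability"
begin

section \<open>Sites and upward jumps\<close>

text \<open>
  \<open>Z^d\<close> is represented as \<open>Z^(d-1) \<times> Z\<close>, so that \<open>d = CARD('n) + 1\<close>; every upward jump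
  increases the second component by one.
\<close>

type_synonym 'n site = "(int ^ 'n) \<times> int"

definition upward :: "'n::finite site set" where
  "upward = {(a, 1) | a. (\<Sum>i\<in>UNIV. \<bar>a $ i\<bar>) = 1}"

abbreviation downward :: "'n::finite site set" where
  "downward \<equiv> uminus ` upward"


section \<open>Path spaces\<close>

definition cylinder_algebra :: "('i \<Rightarrow> 'a) set \<Rightarrow> ('i \<Rightarrow> 'a) measure" where
  "cylinder_algebra S = sigma S {{w \<in> S. w n \<in> A} | n A. True}"

definition bi_paths :: "(int \<Rightarrow> 'n::finite site) set" where
  "bi_paths = {w. \<forall>n. w (n + 1) - w n \<in> upward}"

text \<open>\<open>W\<^sub>+\<close> is \<open>half_paths upward\<close> and \<open>W\<^sub>-\<close> is \<open>half_paths downward\<close>.\<close>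

definition half_paths :: "'n::finite site set \<Rightarrow> (nat \<Rightarrow> 'n site) set" where
  "half_paths S = {w. \<forall>n. w (n + 1) - w n \<in> S}"


section \<open>Laws of the one-sided walks\<close>

text \<open>
  The law of the walk with i.i.d. steps uniform on \<open>S\<close>, started at \<open>x\<close>: the image of the
  infinite product of the uniform measures under the partial-sum map.
\<close>

definition walk :: "'n::finite site \<Rightarrow> (nat \<Rightarrow> 'n site) \<Rightarrow> nat \<Rightarrow> 'n site" where
  "walk x s n = x + (\<Sum>k<n. s k)"

definition steps :: "'n::finite site set \<Rightarrow> (nat \<Rightarrow> 'n site) measure" where
  "steps S = Pi\<^sub>M UNIV (\<lambda>_. uniform_count_measure S)"

definition walk_law :: "'n::finite site set \<Rightarrow> 'n site \<Rightarrow> (nat \<Rightarrow> 'n site) measure" where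
  "walk_law S x = distr (steps S) (cylinder_algebra (half_paths S)) (walk x)"


section \<open>Hitting times\<close>

definition return_time :: "'a set \<Rightarrow> (nat \<Rightarrow> 'a) \<Rightarrow> enat" where
  "return_time K w = Inf (enat ` {n. n \<ge> 1 \<and> w n \<in> K})"

text \<open>As \<open>n\<close> ranges over all integers, the infimum may be \<open>-\<infinity>\<close> as well as \<open>\<infinity>\<close>, hence \<open>ereal\<close>.\<close>

definition entrance_time :: "'a set \<Rightarrow> (int \<Rightarrow> 'a) \<Rightarrow> ereal" where
  "entrance_time K w = Inf ((\<lambda>n. ereal (real_of_int n)) ` {n. w n \<in> K})"

definition entering_at :: "'n::finite site set \<Rightarrow> int \<Rightarrow> (int \<Rightarrow> 'n site) set" where
  "entering_at K n = {w \<in> bi_paths. entrance_time K w = ereal (real_of_int n)}"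

definition entering :: "'n::finite site set \<Rightarrow> (int \<Rightarrow> 'n site) set" where
  "entering K = (\<Union>n. entering_at K n)"


section \<open>Paths modulo time shift\<close>

definition shift_rel :: "((int \<Rightarrow> 'n::finite site) \<times> (int \<Rightarrow> 'n site)) set" where
  "shift_rel = {(w, w'). w \<in> bi_paths \<and> w' \<in> bi_paths \<and> (\<exists>k. \<forall>n. w n = w' (k + n))}"

definition path_classes :: "(int \<Rightarrow> 'n::finite site) set set" where
  "path_classes = bi_paths // shift_rel"

definition path_class :: "(int \<Rightarrow> 'n::finite site) \<Rightarrow> (int \<Rightarrow> 'n site) set" where
  "path_class w = shift_rel `` {w}"

definition class_algebra :: "(int \<Rightarrow> 'n::finite site) set measure" where
  "class_algebra = sigma path_classes
     {A. A \<subseteq> path_classes \<and> path_class -` A \<inter> bi_paths \<in> sets (cylinder_algebra bi_paths)}"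

definition class_entering :: "'n::finite site set \<Rightarrow> (int \<Rightarrow> 'n site) set set" where
  "class_entering K = path_class ` entering K"


section \<open>The measures on doubly infinite paths\<close>

text \<open>\<open>is_Q K\<close> characterises exactly one measure for finite \<open>K\<close>: see \<open>is_Q_exists\<close> and \<open>is_Q_unique\<close>.\<close>

definition is_Q :: "'n::finite site set \<Rightarrow> (int \<Rightarrow> 'n site) measure \<Rightarrow> bool" where
  "is_Q K M \<longleftrightarrow>
     sets M = sets (cylinder_algebra bi_paths) \<and>
     emeasure M (bi_paths - entering_at K 0) = 0 \<and>
     (\<forall>A \<in> sets (cylinder_algebra (half_paths downward)).
      \<forall>B \<in> sets (cylinder_algebra (half_paths upward)). \<forall>x \<in> K.
        emeasure M {w \<in> bi_paths. (\<lambda>n. w (- int n)) \<in> A \<and> w 0 = x \<and> (\<lambda>n. w (int n)) \<in> B} =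
        emeasure (walk_law downward x) (A \<inter> {w. return_time K w = \<infinity>}) *
        emeasure (walk_law upward x) B)"

definition Q :: "'n::finite site set \<Rightarrow> (int \<Rightarrow> 'n site) measure" where
  "Q K = (THE M. is_Q K M)"


section \<open>Well-definedness\<close>

lemma space_cylinder_algebra [simp]: "space (cylinder_algebra S) = S"
  unfolding cylinder_algebra_def by (rule space_measure_of) auto

lemma sets_cylinder_algebra:
  "sets (cylinder_algebra S) = sigma_sets S {{w \<in> S. w n \<in> A} | n A. True}"
  unfolding cylinder_algebra_def by (rule sets_measure_of) auto

lemma cylinder_in_sets [simp, intro]: "{w \<in> S. w n \<in> A} \<in> sets (cylinder_algebra S)"
  unfolding sets_cylinder_algebra by (rule sigma_sets.Basic) blast

lemma measurable_cylinder_algebraI: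
  assumes "\<And>\<omega>. \<omega> \<in> space M \<Longrightarrow> f \<omega> \<in> S"
    and "\<And>n A. {\<omega> \<in> space M. f \<omega> n \<in> A} \<in> sets M"
  shows "f \<in> measurable M (cylinder_algebra S)"
  unfolding cylinder_algebra_def
proof (rule measurable_measure_of)
  fix y assume "y \<in> {{w \<in> S. w n \<in> A} | n A. True}"
  then obtain n A where y: "y = {w \<in> S. w n \<in> A}" by blast
  have "f -` y \<inter> space M = {\<omega> \<in> space M. f \<omega> n \<in> A}"
    using assms(1) unfolding y by auto
  then show "f -` y \<inter> space M \<in> sets M" using assms(2) by simp
qed (use assms(1) in auto)

lemma class_algebra_sets:
  "sets (class_algebra :: (int \<Rightarrow> 'n::finite site) set measure) =
     {A. A \<subseteq> path_classes \<and> path_class -` A \<inter> bi_paths \<in> sets (cylinder_algebra bi_paths)}"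
  (is "_ = ?S")
proof -
  let ?W = "cylinder_algebra (bi_paths :: (int \<Rightarrow> 'n site) set)"
  have im: "path_class w \<in> path_classes" if "w \<in> bi_paths" for w :: "int \<Rightarrow> 'n site"
    using that unfolding path_class_def path_classes_def by (rule quotientI)
  have "sigma_algebra path_classes ?S"
    unfolding sigma_algebra_iff2
  proof (intro conjI ballI allI impI)
    fix A assume "A \<in> ?S"
    moreover have "path_class -` (path_classes - A) \<inter> bi_paths
        = space ?W - path_class -` A \<inter> bi_paths" using im by auto
    ultimately show "path_classes - A \<in> ?S"
      by (metis (no_types, lifting) Diff_subset mem_Collect_eq sets.compl_sets)
  next
    fix A :: "nat \<Rightarrow> _" assume A: "range A \<subseteq> ?S"
    have "path_class -` (\<Union>i. A i) \<inter> bi_paths = (\<Union>i. path_class -` A i \<inter> bi_paths)"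
      by auto
    also have "\<dots> \<in> sets ?W" using A by (intro sets.countable_UN) blast
    finally show "(\<Union>i. A i) \<in> ?S" using A by blast
  qed auto
  then have "sigma_sets path_classes ?S = ?S"
    by (rule sigma_algebra.sigma_sets_eq)
  then show ?thesis unfolding class_algebra_def by (subst sets_measure_of) auto
qed

lemma finite_upward: "finite (upward :: 'n::finite site set)"
proof -
  have "upward \<subseteq> (\<lambda>f. ((\<chi> i. f i), 1)) ` (UNIV \<rightarrow>\<^sub>E {-1..1::int} :: ('n \<Rightarrow> int) set)"
  proof
    fix e :: "'n site" assume "e \<in> upward"
    then obtain a where a: "e = (a, 1)" "(\<Sum>i\<in>UNIV. \<bar>a $ i\<bar>) = 1" unfolding upward_def by auto
    have "\<bar>a $ j\<bar> \<le> 1" for j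
      using member_le_sum[of j UNIV "\<lambda>i. \<bar>a $ i\<bar>"] a by simp
    then have "(\<lambda>i. a $ i) \<in> UNIV \<rightarrow>\<^sub>E {-1..1::int}" by (auto simp: abs_le_iff minus_le_iff)
    then show "e \<in> (\<lambda>f. ((\<chi> i. f i), 1)) ` (UNIV \<rightarrow>\<^sub>E {-1..1::int})"
      using a by (intro image_eqI[of _ _ "\<lambda>i. a $ i"]) (auto simp: vec_eq_iff)
  qed
  then show ?thesis by (rule finite_subset) (auto intro!: finite_PiE)
qed

lemma upward_nonempty: "(upward :: 'n::finite site set) \<noteq> {}"
proof -
  have "((\<chi> i. if i = undefined then 1 else 0), 1) \<in> (upward :: 'n site set)"
    unfolding upward_def by (auto simp: if_distrib cong: if_cong)
  then show ?thesis by auto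
qed

lemma space_steps: "space (steps S) = {s. \<forall>n. s n \<in> S}"
  unfolding steps_def by (auto simp: space_PiM space_uniform_count_measure PiE_def Pi_def)

lemma prob_space_steps:
  assumes "finite S" "S \<noteq> {}" shows "prob_space (steps S)"
proof -
  interpret prob_space "uniform_count_measure S" by (rule prob_space_uniform_count_measure[OF assms])
  interpret product_prob_space "\<lambda>_::nat. uniform_count_measure S" UNIV by unfold_locales
  show ?thesis unfolding steps_def by unfold_locales
qed

lemma measurable_partial_sum:
  "(\<lambda>s. walk x s n) \<in> measurable (steps S) (count_space UNIV)"
proof (induction n)
  case (Suc n)
  have c: "(\<lambda>s. s n) \<in> measurable (steps S) (count_space UNIV)"
  proof -
    have "(\<lambda>s. s n) \<in> measurable (steps S) (uniform_count_measure S)"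
      unfolding steps_def by simp
    moreover have "(\<lambda>x. x) \<in> measurable (uniform_count_measure S) (count_space UNIV)"
      by (auto simp: measurable_def space_uniform_count_measure sets_uniform_count_measure)
    ultimately show ?thesis using measurable_compose by blast
  qed
  have "(\<lambda>s. walk x s n + s n) \<in> measurable (steps S) (count_space UNIV)"
    by (rule measurable_compose_countable[OF _ Suc]) (rule measurable_compose[OF c], simp)
  then show ?case by (simp add: walk_def add.assoc)
qed (simp add: walk_def)

lemma measurable_walk [measurable]:
  "walk x \<in> measurable (steps S) (cylinder_algebra (half_paths S))"
proof (rule measurable_cylinder_algebraI)
  show "walk x s \<in> half_paths S" if "s \<in> space (steps S)" for s
    using that by (simp add: half_paths_def walk_def space_steps)
  show "{s \<in> space (steps S). walk x s n \<in> A} \<in> sets (steps S)" for n A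
    using measurable_sets[OF measurable_partial_sum, of A x n S]
    by (simp add: vimage_def Int_def conj_commute)
qed

lemma return_time_eq_infinity: "return_time K w = \<infinity> \<longleftrightarrow> (\<forall>n\<ge>1. w n \<notin> K)"
proof
  assume l: "return_time K w = \<infinity>"
  show "\<forall>n\<ge>1. w n \<notin> K"
  proof (intro allI impI notI)
    fix n :: nat assume "1 \<le> n" "w n \<in> K"
    then have "return_time K w \<le> enat n" unfolding return_time_def by (intro Inf_lower) auto
    then show False using l by simp
  qed
next
  assume "\<forall>n\<ge>1. w n \<notin> K"
  then have "{n. n \<ge> 1 \<and> w n \<in> K} = {}" by auto
  then show "return_time K w = \<infinity>"
    unfolding return_time_def by (simp only: image_empty Inf_empty top_enat_def)
qed

lemma entering_at_0: "entering_at K 0 = {w \<in> bi_paths. w 0 \<in> K \<and> (\<forall>n\<ge>1. w (- int n) \<notin> K)}"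
proof -
  have "entrance_time K w = 0 \<longleftrightarrow> w 0 \<in> K \<and> (\<forall>n\<ge>1. w (- int n) \<notin> K)" (is "?l \<longleftrightarrow> ?r") for w
  proof
    assume l: ?l
    have ge: "0 \<le> m" if "w m \<in> K" for m
    proof -
      have "entrance_time K w \<le> ereal (real_of_int m)"
        unfolding entrance_time_def by (rule INF_lower) (use that in simp)
      then show ?thesis using l by simp
    qed
    have "w 0 \<in> K"
    proof (rule ccontr)
      assume "w 0 \<notin> K"
      then have "1 \<le> m" if "w m \<in> K" for m
        using ge[OF that] that by (cases "m = 0") auto
      then have "1 \<le> entrance_time K w"
        unfolding entrance_time_def by (intro INF_greatest) auto
      then show False using l by simp
    qed
    moreover have "w (- int n) \<notin> K" if "n \<ge> 1" for n
      using ge[of "- int n"] that by auto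
    ultimately show ?r by blast
  next
    assume r: ?r
    have "0 \<le> m" if "w m \<in> K" for m
    proof (rule ccontr)
      assume "\<not> 0 \<le> m"
      then have "nat (- m) \<ge> 1" by simp
      then have "w (- int (nat (- m))) \<notin> K" using r by blast
      then show False using that \<open>\<not> 0 \<le> m\<close> by simp
    qed
    then have "0 \<le> entrance_time K w"
      unfolding entrance_time_def by (intro INF_greatest) auto
    moreover have "entrance_time K w \<le> ereal (real_of_int 0)"
      unfolding entrance_time_def by (rule INF_lower) (use r in simp)
    ultimately show ?l by (simp add: zero_ereal_def)
  qed
  then show ?thesis unfolding entering_at_def by (simp add: zero_ereal_def)
qed

lemma never_return_sets:
  "{w \<in> S. return_time K w = \<infinity>} \<in> sets (cylinder_algebra S)"
proof -
  have "{w \<in> S. return_time K w = \<infinity>} =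
      space (cylinder_algebra S) - (\<Union>n\<in>{1..}. {w \<in> S. w n \<in> K})"
    by (auto simp: return_time_eq_infinity)
  also have "\<dots> \<in> sets (cylinder_algebra S)" by (intro sets.Diff sets.top sets.countable_UN'') auto
  finally show ?thesis .
qed

lemma entering_at_0_sets: "entering_at K 0 \<in> sets (cylinder_algebra bi_paths)"
proof -
  have "entering_at K 0 =
      {w \<in> bi_paths. w 0 \<in> K} - (\<Union>n\<in>{1..}. {w \<in> bi_paths. w (- int n) \<in> K})"
    by (auto simp: entering_at_0)
  also have "\<dots> \<in> sets (cylinder_algebra bi_paths)" by (intro sets.Diff sets.countable_UN'') auto
  finally show ?thesis .
qed

definition Q_event ::
  "(nat \<Rightarrow> 'n::finite site) set \<Rightarrow> 'n site \<Rightarrow> (nat \<Rightarrow> 'n site) set \<Rightarrow> (int \<Rightarrow> 'n site) set" where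
  "Q_event A x B = {w \<in> bi_paths. (\<lambda>n. w (- int n)) \<in> A \<and> w 0 = x \<and> (\<lambda>n. w (int n)) \<in> B}"

lemma measurable_future:
  "(\<lambda>w n. w (int n)) \<in> measurable (cylinder_algebra bi_paths) (cylinder_algebra (half_paths upward))"
proof (rule measurable_cylinder_algebraI)
  fix w :: "int \<Rightarrow> 'n::finite site" assume "w \<in> space (cylinder_algebra bi_paths)"
  then have "w (int n + 1) - w (int n) \<in> upward" for n by (simp add: bi_paths_def)
  then have "w (int (n + 1)) - w (int n) \<in> upward" for n by (metis of_nat_add of_nat_1)
  then show "(\<lambda>n. w (int n)) \<in> half_paths upward" by (simp add: half_paths_def)
qed simp

lemma measurable_past:
  "(\<lambda>w n. w (- int n)) \<in> measurable (cylinder_algebra bi_paths) (cylinder_algebra (half_paths downward))"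
proof (rule measurable_cylinder_algebraI)
  fix w :: "int \<Rightarrow> 'n::finite site" assume "w \<in> space (cylinder_algebra bi_paths)"
  then have w: "w (m + 1) - w m \<in> upward" for m by (simp add: bi_paths_def)
  have "w (- int (n + 1)) - w (- int n) \<in> downward" for n
    by (rule image_eqI[OF _ w[of "- int (n + 1)"]]) simp
  then show "(\<lambda>n. w (- int n)) \<in> half_paths downward" by (simp add: half_paths_def)
qed simp

lemma Q_event_sets:
  assumes "A \<in> sets (cylinder_algebra (half_paths downward))"
    and "B \<in> sets (cylinder_algebra (half_paths upward))"
  shows "Q_event A x B \<in> sets (cylinder_algebra bi_paths)"
proof -
  have "Q_event A x B = ((\<lambda>w n. w (- int n)) -` A \<inter> space (cylinder_algebra bi_paths)) \<inter>
     {w \<in> bi_paths. w 0 \<in> {x}} \<inter> ((\<lambda>w n. w (int n)) -` B \<inter> space (cylinder_algebra bi_paths))"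
    by (auto simp: Q_event_def)
  also have "\<dots> \<in> sets (cylinder_algebra bi_paths)"
    by (intro sets.Int[OF sets.Int] measurable_sets[OF measurable_past assms(1)]
        measurable_sets[OF measurable_future assms(2)] cylinder_in_sets)
  finally show ?thesis .
qed

lemma is_Q_unique:
  fixes K :: "'n::finite site set"
  assumes K: "finite K" and M: "is_Q K M" and N: "is_Q K N"
  shows "M = N"
proof (rule measure_eqI_generator_eq_countable)
  let ?D = "sets (cylinder_algebra (half_paths (downward :: 'n site set)))"
  let ?U = "sets (cylinder_algebra (half_paths (upward :: 'n site set)))"
  let ?W = "cylinder_algebra (bi_paths :: (int \<Rightarrow> 'n site) set)"
  let ?E = "{Q_event A x B | A x B. A \<in> ?D \<and> B \<in> ?U} \<union> {{}}"
  let ?C = "range (\<lambda>x. Q_event (half_paths downward) x (half_paths (upward :: 'n site set)))"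
  have D: "half_paths downward \<in> ?D" and U: "half_paths upward \<in> ?U"
    using sets.top space_cylinder_algebra by metis+
  show "?E \<subseteq> Pow bi_paths" by (auto simp: Q_event_def)
  show "Int_stable ?E"
  proof (rule Int_stableI)
    fix a b assume "a \<in> ?E" "b \<in> ?E"
    then consider "a \<inter> b = {}" | A x B A' x' B' where "a = Q_event A x B" "b = Q_event A' x' B'"
      "A \<in> ?D" "B \<in> ?U" "A' \<in> ?D" "B' \<in> ?U" by blast
    then show "a \<inter> b \<in> ?E"
    proof cases
      case 2
      show ?thesis
      proof (cases "x = x'")
        case True
        have "a \<inter> b = Q_event (A \<inter> A') x (B \<inter> B')" using 2 True by (auto simp: Q_event_def)
        then show ?thesis using 2 by blast
      next
        case False
        then have "a \<inter> b = {}" using 2 by (auto simp: Q_event_def)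
        then show ?thesis by simp
      qed
    qed simp
  qed
  have zero: "emeasure L (Q_event A x B) = 0" if "is_Q K L" "x \<notin> K" for L A x B
  proof -
    have "emeasure L (Q_event A x B) \<le> emeasure L (bi_paths - entering_at K 0)"
      using that entering_at_0_sets[of K] sets.top[of ?W]
      by (intro emeasure_mono) (auto simp: is_Q_def Q_event_def entering_at_0)
    then show ?thesis using that by (simp add: is_Q_def)
  qed
  have val: "emeasure L (Q_event A x B) =
      emeasure (walk_law downward x) (A \<inter> {w. return_time K w = \<infinity>}) * emeasure (walk_law upward x) B"
    if "is_Q K L" "A \<in> ?D" "B \<in> ?U" "x \<in> K" for L A x B
    using that by (auto simp: is_Q_def Q_event_def)
  show "emeasure M X = emeasure N X" if "X \<in> ?E" for X
  proof (cases "X = {}")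
    case False
    then obtain A x B where "X = Q_event A x B" "A \<in> ?D" "B \<in> ?U" using \<open>X \<in> ?E\<close> by blast
    then show ?thesis using val[OF M, of A B x] val[OF N, of A B x] zero[OF M, of x A B] zero[OF N, of x A B]
      by (cases "x \<in> K") simp_all
  qed simp
  have gen: "sets ?W = sigma_sets bi_paths ?E"
  proof
    have "sigma_sets bi_paths ?E \<subseteq> sigma_sets (space ?W) (sets ?W)"
      unfolding space_cylinder_algebra by (rule sigma_sets_mono') (auto intro: Q_event_sets)
    then show "sigma_sets bi_paths ?E \<subseteq> sets ?W" unfolding sets.sigma_sets_eq .
    interpret S: sigma_algebra bi_paths "sigma_sets bi_paths ?E"
      by (rule sigma_algebra_sigma_sets) fact
    have "{w \<in> bi_paths. w n \<in> A} \<in> sigma_sets bi_paths ?E" for n A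
    proof -
      define a where "a = (if n \<ge> 0 then half_paths downward
         else {w \<in> half_paths (downward :: 'n site set). w (nat (- n)) \<in> A})"
      define b where "b = (if n \<ge> 0 then {w \<in> half_paths (upward :: 'n site set). w (nat n) \<in> A}
         else half_paths upward)"
      have ab: "a \<in> ?D" "b \<in> ?U" using D U by (auto simp: a_def b_def)
      have "{w \<in> bi_paths. w n \<in> A} = (\<Union>x. Q_event a x b)"
        using measurable_space[OF measurable_past] measurable_space[OF measurable_future]
        by (auto simp: Q_event_def a_def b_def)
      also have "\<dots> \<in> sigma_sets bi_paths ?E"
        using ab by (intro S.countable_UN) auto
      finally show ?thesis .
    qed
    then show "sets ?W \<subseteq> sigma_sets bi_paths ?E"
      unfolding sets_cylinder_algebra[of bi_paths] by (intro S.sigma_sets_subset) blast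
  qed
  show "sets M = sigma_sets bi_paths ?E" "sets N = sigma_sets bi_paths ?E"
    using M N gen by (auto simp: is_Q_def)
  show "?C \<subseteq> ?E" using D U by blast
  have "w \<in> Q_event (half_paths downward) (w 0) (half_paths upward)" if "w \<in> bi_paths" for w :: "int \<Rightarrow> 'n site"
    using that measurable_space[OF measurable_past] measurable_space[OF measurable_future]
    by (auto simp: Q_event_def)
  then have "bi_paths \<subseteq> \<Union> ?C" by (intro subsetI UN_I[OF UNIV_I])
  moreover have "\<Union> ?C \<subseteq> bi_paths" unfolding Q_event_def by (intro UN_least) simp
  ultimately show "\<Union> ?C = bi_paths" by (rule equalityI[rotated])
  show "countable ?C" by simp
  show "emeasure M c \<noteq> \<infinity>" if "c \<in> ?C" for c
  proof -
    from \<open>c \<in> ?C\<close> obtain x where c: "c = Q_event (half_paths downward) x (half_paths upward)"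
      by (rule rangeE)
    have fin: "emeasure (walk_law S x) X \<noteq> \<infinity>" if "finite S" "S \<noteq> {}" for S X
    proof -
      interpret prob_space "walk_law S x" unfolding walk_law_def
        by (intro prob_space.prob_space_distr prob_space_steps that) measurable
      show ?thesis by simp
    qed
    show ?thesis
    proof (cases "x \<in> K")
      case True
      have "emeasure (walk_law (upward :: 'n site set) x) X \<noteq> \<infinity>"
        "emeasure (walk_law (downward :: 'n site set) x) X \<noteq> \<infinity>" for X
        using fin finite_upward upward_nonempty by (metis finite_imageI image_is_empty)+
      then show ?thesis unfolding c val[OF M D U True] by (simp add: ennreal_mult_eq_top_iff)
    qed (simp add: c zero[OF M])
  qed
qed

definition glue :: "'n::finite site \<Rightarrow> (nat \<Rightarrow> 'n site) \<times> (nat \<Rightarrow> 'n site) \<Rightarrow> int \<Rightarrow> 'n site" where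
  "glue x p n = (if n \<ge> 0 then walk x (snd p) (nat n) else walk x (fst p) (nat (- n)))"

lemma measurable_glue:
  fixes x :: "'n::finite site"
  shows "glue x \<in> measurable (steps downward \<Otimes>\<^sub>M steps upward) (cylinder_algebra bi_paths)"
proof (rule measurable_cylinder_algebraI)
  let ?P = "steps (downward :: 'n site set) \<Otimes>\<^sub>M steps upward"
  fix p :: "(nat \<Rightarrow> 'n site) \<times> (nat \<Rightarrow> 'n site)" assume "p \<in> space ?P"
  then have p: "\<And>n. fst p n \<in> downward" "\<And>n. snd p n \<in> upward"
    by (auto simp: space_pair_measure space_steps)
  have "glue x p (n + 1) - glue x p n \<in> upward" for n
  proof (cases "n \<ge> 0")
    case True
    then have "glue x p (n + 1) - glue x p n = snd p (nat n)"
      by (simp add: glue_def walk_def nat_add_distrib)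
    then show ?thesis using p by simp
  next
    case False
    define m where "m = nat (- n) - 1"
    have n: "n = - int (Suc m)" using False by (simp add: m_def)
    have "glue x p (n + 1) - glue x p n = - fst p m"
      unfolding n by (auto simp: glue_def walk_def nat_add_distrib)
    then show ?thesis using p(1)[of m] by auto
  qed
  then show "glue x p \<in> bi_paths" by (simp add: bi_paths_def)
next
  let ?P = "steps (downward :: 'n site set) \<Otimes>\<^sub>M steps upward"
  fix n A
  have "(\<lambda>p. glue x p n) \<in> measurable ?P (count_space UNIV)"
    unfolding glue_def
    by (cases "n \<ge> 0") (simp_all add: measurable_compose[OF measurable_fst measurable_partial_sum]
         measurable_compose[OF measurable_snd measurable_partial_sum])
  from measurable_sets[OF this, of A]
  show "{p \<in> space ?P. glue x p n \<in> A} \<in> sets ?P"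
    by (simp add: vimage_def Int_def conj_commute)
qed

lemma is_Q_exists:
  fixes K :: "'n::finite site set"
  assumes K: "finite K"
  shows "\<exists>M. is_Q K M"
proof -
  let ?D = "steps (downward :: 'n site set)" and ?U = "steps (upward :: 'n site set)"
  let ?P = "?D \<Otimes>\<^sub>M ?U"
  let ?W = "cylinder_algebra (bi_paths :: (int \<Rightarrow> 'n site) set)"
  interpret U: prob_space ?U by (intro prob_space_steps finite_upward upward_nonempty)
  define N where "N y = distr ?P ?W (glue y)" for y
  define \<mu> where "\<mu> E = (\<Sum>y\<in>K. emeasure (N y) (E \<inter> entering_at K 0))" for E
  define M where "M = measure_of bi_paths (sets ?W) \<mu>"
  have setsN [simp]: "sets (N y) = sets ?W" for y by (simp add: N_def)
  have sub: "sets ?W \<subseteq> Pow bi_paths" using sets.space_closed[of ?W] by simp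
  have sM: "sets M = sets ?W"
    unfolding M_def using sub sets.sigma_sets_eq[of ?W] by simp
  have eM: "emeasure M E = \<mu> E" if E: "E \<in> sets ?W" for E
  proof (rule emeasure_measure_of[OF M_def])
    show "positive (sets M) \<mu>" by (simp add: positive_def \<mu>_def)
    show "countably_additive (sets M) \<mu>"
    proof (rule countably_additiveI)
      fix A :: "nat \<Rightarrow> _" assume A: "range A \<subseteq> sets M" "disjoint_family A"
      have "(\<Sum>i. \<mu> (A i)) = (\<Sum>y\<in>K. \<Sum>i. emeasure (N y) (A i \<inter> entering_at K 0))"
        unfolding \<mu>_def by (rule suminf_sum) simp
      also have "\<dots> = \<mu> (\<Union>i. A i)" unfolding \<mu>_def
      proof (rule sum.cong[OF refl])
        fix y
        have "(\<Sum>i. emeasure (N y) (A i \<inter> entering_at K 0)) =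
            emeasure (N y) (\<Union>i. A i \<inter> entering_at K 0)"
          using A sM entering_at_0_sets[of K]
          by (intro suminf_emeasure) (auto simp: disjoint_family_on_def)
        then show "(\<Sum>i. emeasure (N y) (A i \<inter> entering_at K 0)) =
            emeasure (N y) ((\<Union>i. A i) \<inter> entering_at K 0)" by simp
      qed
      finally show "(\<Sum>i. \<mu> (A i)) = \<mu> (\<Union>i. A i)" .
    qed
  qed (use sub E sM in auto)
  have formula: "emeasure M (Q_event A x B) =
      emeasure (walk_law downward x) (A \<inter> {w. return_time K w = \<infinity>}) * emeasure (walk_law upward x) B"
    if A: "A \<in> sets (cylinder_algebra (half_paths downward))"
      and B: "B \<in> sets (cylinder_algebra (half_paths upward))" and x: "x \<in> K" for A x B
  proof -
    let ?A = "A \<inter> {w. return_time K w = \<infinity>}"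
    have "A \<subseteq> half_paths downward" using sets.sets_into_space[OF A] by simp
    then have "?A = A \<inter> {w \<in> half_paths downward. return_time K w = \<infinity>}" by blast
    also have "\<dots> \<in> sets (cylinder_algebra (half_paths downward))"
      by (rule sets.Int[OF A never_return_sets])
    finally have A': "?A \<in> sets (cylinder_algebra (half_paths downward))" .
    have past: "(\<lambda>n. glue y p (- int n)) = walk y (fst p)" for y :: "'n site" and p
      by (auto simp: glue_def walk_def fun_eq_iff)
    have fut: "(\<lambda>n. glue y p (int n)) = walk y (snd p)" for y :: "'n site" and p
      by (auto simp: glue_def fun_eq_iff)
    have g0: "glue y p 0 = y" for y :: "'n site" and p by (simp add: glue_def walk_def)
    have pre: "glue y -` (Q_event A x B \<inter> entering_at K 0) \<inter> space ?P =
       (if y = x then (walk x -` ?A \<inter> space ?D) \<times> (walk x -` B \<inter> space ?U) else {})" for y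
    proof (rule set_eqI)
      fix p
      have e: "return_time K (walk y (fst p)) = \<infinity> \<longleftrightarrow> (\<forall>n\<ge>1. glue y p (- int n) \<notin> K)"
        unfolding past[symmetric] return_time_eq_infinity by simp
      have "glue y p \<in> bi_paths" if "p \<in> space ?P"
        using measurable_space[OF measurable_glue that] by simp
      then show "p \<in> glue y -` (Q_event A x B \<inter> entering_at K 0) \<inter> space ?P \<longleftrightarrow>
        p \<in> (if y = x then (walk x -` ?A \<inter> space ?D) \<times> (walk x -` B \<inter> space ?U) else {})"
        using x e by (cases p) (auto simp: Q_event_def entering_at_0 past fut g0 space_pair_measure)
    qed
    have "emeasure M (Q_event A x B) = (\<Sum>y\<in>K. emeasure (N y) (Q_event A x B \<inter> entering_at K 0))"
      using eM[OF Q_event_sets[OF A B]] by (simp add: \<mu>_def)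
    also have "\<dots> = (\<Sum>y\<in>K. if y = x then
        emeasure ?P ((walk x -` ?A \<inter> space ?D) \<times> (walk x -` B \<inter> space ?U)) else 0)"
      unfolding N_def
      by (intro sum.cong refl, subst emeasure_distr[OF measurable_glue])
        (simp_all add: Q_event_sets[OF A B] entering_at_0_sets sets.Int pre del: vimage_Int)
    also have "\<dots> = emeasure ?P ((walk x -` ?A \<inter> space ?D) \<times> (walk x -` B \<inter> space ?U))"
      using K x by simp
    also have "\<dots> = emeasure ?D (walk x -` ?A \<inter> space ?D) * emeasure ?U (walk x -` B \<inter> space ?U)"
      by (intro U.emeasure_pair_measure_Times measurable_sets[OF measurable_walk] A' B)
    also have "\<dots> = emeasure (walk_law downward x) ?A * emeasure (walk_law upward x) B"
      unfolding walk_law_def by (simp add: emeasure_distr[OF measurable_walk] A' B)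
    finally show ?thesis .
  qed
  have "emeasure M (bi_paths - entering_at K 0) = 0"
  proof -
    have "bi_paths - entering_at K 0 \<in> sets ?W"
      using sets.compl_sets[OF entering_at_0_sets[of K]] by simp
    moreover have "(bi_paths - entering_at K 0) \<inter> entering_at K 0 = {}" by blast
    ultimately show ?thesis using eM by (simp add: \<mu>_def)
  qed
  then have "is_Q K M" using sM formula by (auto simp: is_Q_def Q_event_def)
  then show ?thesis by blast
qed

theorem is_Q_Q: "finite K \<Longrightarrow> is_Q K (Q K)"
  unfolding Q_def using is_Q_exists is_Q_unique by (metis theI)

end

theory Submission
  imports Defs
begin

text \<open>
  Start the two-sided walk at time \<open>0\<close> from counting measure on the sites. The resulting
  \<open>\<sigma>\<close>-finite measure on paths is invariant under time shifts, and its restriction to the paths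
  entering \<open>K\<close> at time \<open>0\<close> is \<open>Q K\<close>. The measure \<open>\<nu>\<close> is its restriction to the paths at height
  \<open>0\<close> at time \<open>0\<close>, pushed to classes. Cutting \<open>\<nu>\<close> on \<open>W\<^sub>K\<^sup>*\<close> according to the entrance time \<open>m\<close>
  and shifting each piece by \<open>m\<close> turns the condition on the height into the condition that \<open>K\<close> is
  entered at time \<open>0\<close>. Uniqueness holds because finite sets \<open>K\<close> exhaust the lattice, so that the
  sets \<open>W\<^sub>K\<^sup>*\<close> exhaust \<open>W\<^sup>*\<close>.
\<close>

section \<open>Invariance under time shift of the walk started from counting measure\<close>

lemma measurable_case_nat_steps [measurable]:
  "(\<lambda>(e, s). case_nat e s) \<in> measurable (uniform_count_measure S \<Otimes>\<^sub>M steps S) (steps S)"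
  unfolding steps_def by measurable

text \<open>An i.i.d. sequence is an independent first step put in front of a fresh copy of the
  sequence. This is \<open>PiM_iter\<close>; Fubini then turns the integral over the first step into
  a finite average. It is used once for the past and once for the future.\<close>

lemma nn_integral_steps:
  assumes S: "finite S" "S \<noteq> {}" and f: "f \<in> borel_measurable (steps S)"
  shows "(\<integral>\<^sup>+s. f s \<partial>steps S) = (\<Sum>e\<in>S. ennreal (1 / card S) * (\<integral>\<^sup>+s. f (case_nat e s) \<partial>steps S))"
proof -
  interpret U: prob_space "uniform_count_measure S" by (rule prob_space_uniform_count_measure[OF S])
  interpret sequence_space "uniform_count_measure S" by unfold_locales
  interpret T: prob_space "steps S" by (rule prob_space_steps[OF S])
  have "steps S = distr (uniform_count_measure S \<Otimes>\<^sub>M steps S) (steps S) (\<lambda>(e, s). case_nat e s)"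
    using PiM_iter by (simp add: steps_def)
  then have "(\<integral>\<^sup>+s. f s \<partial>steps S) =
      (\<integral>\<^sup>+s. f s \<partial>distr (uniform_count_measure S \<Otimes>\<^sub>M steps S) (steps S) (\<lambda>(e, s). case_nat e s))"
    by simp
  also have "\<dots> = (\<integral>\<^sup>+p. f (case p of (e, s) \<Rightarrow> case_nat e s) \<partial>(uniform_count_measure S \<Otimes>\<^sub>M steps S))"
    using f by (intro nn_integral_distr[OF measurable_case_nat_steps]) simp
  also have "\<dots> = (\<integral>\<^sup>+e. (\<integral>\<^sup>+s. f (case_nat e s) \<partial>steps S) \<partial>uniform_count_measure S)"
    using T.nn_integral_fst[OF measurable_compose[OF measurable_case_nat_steps f]] by simp
  also have "\<dots> = (\<Sum>e\<in>S. ennreal (1 / card S) * (\<integral>\<^sup>+s. f (case_nat e s) \<partial>steps S))"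
    unfolding uniform_count_measure_def by (rule nn_integral_point_measure_finite[OF S(1)])
  finally show ?thesis .
qed

lemma measurable_case_nat_step:
  assumes "e \<in> S"
  shows "case_nat e \<in> measurable (steps S) (steps S)"
proof -
  have "(\<lambda>s. (e, s)) \<in> measurable (steps S) (uniform_count_measure S \<Otimes>\<^sub>M steps S)"
    using assms by (intro measurable_Pair1') (simp add: space_uniform_count_measure)
  from measurable_compose[OF this measurable_case_nat_steps] show ?thesis by simp
qed

section \<open>The two-sided walk and its mixture over all starting sites\<close>

abbreviation two_sided_steps :: "((nat \<Rightarrow> 'n::finite site) \<times> (nat \<Rightarrow> 'n site)) measure" where
  "two_sided_steps \<equiv> steps downward \<Otimes>\<^sub>M steps upward"

definition walk_through :: "'n::finite site \<Rightarrow> (int \<Rightarrow> 'n site) measure" where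
  "walk_through x = distr two_sided_steps (cylinder_algebra bi_paths) (glue x)"

text \<open>Counting measure on the sites is invariant under translations, which makes invariance
  under time shifts possible; the total mass is infinite. Writing it as an image of a product
  measure gives countable additivity for free.\<close>

definition stationary_walk :: "(int \<Rightarrow> 'n::finite site) measure" where
  "stationary_walk = distr (count_space UNIV \<Otimes>\<^sub>M two_sided_steps) (cylinder_algebra bi_paths)
     (\<lambda>(x, p). glue x p)"

definition time_shift :: "int \<Rightarrow> (int \<Rightarrow> 'a) \<Rightarrow> int \<Rightarrow> 'a" where
  "time_shift k w = (\<lambda>n. w (k + n))"

lemma sets_stationary_walk [simp]: "sets stationary_walk = sets (cylinder_algebra bi_paths)"
  by (simp add: stationary_walk_def)

lemma space_stationary_walk [simp]: "space stationary_walk = bi_paths"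
  by (simp add: stationary_walk_def)

lemma time_shift_shift [simp]: "time_shift k (time_shift l w) = time_shift (k + l) w"
  by (simp add: time_shift_def algebra_simps)

lemma time_shift_0 [simp]: "time_shift 0 w = w"
  by (simp add: time_shift_def)

lemma time_shift_in_bi_paths_iff [simp]: "time_shift k w \<in> bi_paths \<longleftrightarrow> w \<in> bi_paths"
proof -
  have "time_shift k w \<in> bi_paths" if "w \<in> bi_paths" for k and w :: "int \<Rightarrow> 'a site"
    using that by (simp add: time_shift_def bi_paths_def flip: add.assoc)
  from this[of w k] this[of "time_shift k w" "- k"] show ?thesis by auto
qed

lemma measurable_time_shift [measurable]:
  "time_shift k \<in> measurable (cylinder_algebra bi_paths) (cylinder_algebra bi_paths)"
  by (rule measurable_cylinder_algebraI) (simp_all, simp add: time_shift_def)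

lemma prob_space_upward: "prob_space (steps (upward :: 'n::finite site set))"
  by (intro prob_space_steps finite_upward upward_nonempty)

lemma prob_space_downward: "prob_space (steps (downward :: 'n::finite site set))"
  by (intro prob_space_steps finite_imageI finite_upward) (simp add: upward_nonempty)

lemma prob_space_two_sided_steps:
  "prob_space (two_sided_steps :: ((nat \<Rightarrow> 'n::finite site) \<times> (nat \<Rightarrow> 'n site)) measure)"
  using prob_space_upward prob_space_downward by (rule prob_space_pair[rotated])

lemma emeasure_stationary_walk:
  assumes F: "F \<in> sets (cylinder_algebra bi_paths)"
  shows "emeasure stationary_walk F =
    (\<integral>\<^sup>+x. emeasure (walk_through x) F \<partial>count_space (UNIV :: 'n::finite site set))"
proof -
  let ?P = "two_sided_steps :: ((nat \<Rightarrow> 'n site) \<times> (nat \<Rightarrow> 'n site)) measure"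
  let ?g = "\<lambda>(x, p). glue x p :: int \<Rightarrow> 'n site"
  interpret P: prob_space ?P by (rule prob_space_two_sided_steps)
  \<comment> \<open>There are only countably many sites, so joint measurability reduces to that of
    \<open>glue x\<close> for each fixed \<open>x\<close>.\<close>
  have g: "?g \<in> measurable (count_space UNIV \<Otimes>\<^sub>M ?P) (cylinder_algebra bi_paths)"
    by (rule measurable_pair_measure_countable1) (simp_all add: measurable_glue)
  have "emeasure stationary_walk F = emeasure (count_space UNIV \<Otimes>\<^sub>M ?P) (?g -` F \<inter> space (count_space UNIV \<Otimes>\<^sub>M ?P))"
    unfolding stationary_walk_def by (rule emeasure_distr[OF g F])
  also have "\<dots> = (\<integral>\<^sup>+x. emeasure ?P (Pair x -` (?g -` F \<inter> space (count_space UNIV \<Otimes>\<^sub>M ?P))) \<partial>count_space UNIV)"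
    by (rule P.emeasure_pair_measure_alt) (rule measurable_sets[OF g F])
  also have "\<dots> = (\<integral>\<^sup>+x. emeasure (walk_through x) F \<partial>count_space UNIV)"
  proof (rule nn_integral_cong)
    fix x
    have "Pair x -` (?g -` F \<inter> space (count_space UNIV \<Otimes>\<^sub>M ?P)) = glue x -` F \<inter> space ?P"
      by (auto simp: space_pair_measure)
    then show "emeasure ?P (Pair x -` (?g -` F \<inter> space (count_space UNIV \<Otimes>\<^sub>M ?P))) = emeasure (walk_through x) F"
      by (simp add: walk_through_def emeasure_distr[OF measurable_glue F])
  qed
  finally show ?thesis .
qed

lemma emeasure_walk_through:
  fixes x :: "'n::finite site"
  assumes F: "F \<in> sets (cylinder_algebra bi_paths)"
  shows "emeasure (walk_through x) F =
    (\<integral>\<^sup>+a. (\<integral>\<^sup>+b. indicator F (glue x (a, b)) \<partial>steps upward) \<partial>steps downward)"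
proof -
  interpret U: prob_space "steps (upward :: 'n site set)" by (rule prob_space_upward)
  have f: "(\<lambda>w. indicator F w :: ennreal) \<in> borel_measurable (cylinder_algebra bi_paths)"
    using F by simp
  have "emeasure (walk_through x) F = (\<integral>\<^sup>+w. indicator F w \<partial>walk_through x)"
    using F by (simp add: walk_through_def)
  also have "\<dots> = (\<integral>\<^sup>+p. indicator F (glue x p) \<partial>two_sided_steps)"
    unfolding walk_through_def using f by (intro nn_integral_distr[OF measurable_glue]) simp
  also have "\<dots> = (\<integral>\<^sup>+a. (\<integral>\<^sup>+b. indicator F (glue x (a, b)) \<partial>steps upward) \<partial>steps downward)"
    by (rule U.nn_integral_fst[symmetric]) (rule measurable_compose[OF measurable_glue f])
  finally show ?thesis .
qed

text \<open>Moving the time origin forward by one makes the first future step \<open>e\<close> the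
  most recent past step. The past is read backwards in time, so that step appears there as
  \<open>- e\<close>, and the new origin is the site \<open>x + e\<close>.\<close>

lemma time_shift_glue_case_nat:
  "time_shift 1 (glue x (a, case_nat e b)) = glue (x + e) (case_nat (- e) a, b)"
proof
  have walk_case: "walk y (case_nat c s) (Suc n) = walk (y + c) s n" for y c :: "'a site" and s n
    unfolding walk_def by (subst sum.lessThan_Suc_shift) (simp add: add.assoc)
  fix n :: int
  \<comment> \<open>Time \<open>-1\<close> is separate because after the shift it is the old origin:
    it lies on the future branch of \<open>glue\<close> on the left and on the past branch on the
    right, where the new step \<open>- e\<close> leads back from \<open>x + e\<close> to
    \<open>x\<close>.\<close>
  consider "n \<ge> 0" | "n = -1" | m where "n = - int (Suc (Suc m))"
  proof (cases n rule: int_cases)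
    case (neg j)
    then show ?thesis using that by (cases j) auto
  qed (use that in simp)
  then show "time_shift 1 (glue x (a, case_nat e b)) n = glue (x + e) (case_nat (- e) a, b) n"
  proof cases
    case 1
    then have "nat (1 + n) = Suc (nat n)" by simp
    then show ?thesis using 1 by (simp add: time_shift_def glue_def walk_case)
  next
    case 2
    then show ?thesis by (simp add: time_shift_def glue_def walk_def)
  next
    case 3
    then have "nat (- n) = Suc (Suc m)" "nat (- (1 + n)) = Suc m" by simp_all
    then show ?thesis using 3 by (simp add: time_shift_def glue_def walk_case)
  qed
qed

text \<open>
  Peeling off the first step \<open>e\<close> into the future, or \<open>-e\<close> into the past, reduces both sides to the
  same sum, up to the substitution \<open>x \<mapsto> x + e\<close>, which preserves counting measure.
\<close>

lemma emeasure_stationary_walk_time_shift_1: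
  assumes F: "F \<in> sets (cylinder_algebra bi_paths)"
  shows "emeasure stationary_walk {w \<in> bi_paths. time_shift 1 w \<in> F} =
    emeasure (stationary_walk :: (int \<Rightarrow> 'n::finite site) measure) F"
proof -
  let ?D = "steps (downward :: 'n site set)" and ?U = "steps (upward :: 'n site set)"
  let ?up = "upward :: 'n site set"
  interpret U: prob_space ?U by (rule prob_space_upward)
  define c where "c = ennreal (1 / card ?up)"
  \<comment> \<open>\<open>R y e\<close> is the mass of those paths in \<open>F\<close> that are at
    \<open>y\<close> at time 0 and arrived there by the jump \<open>e\<close>.\<close>
  define R where
    "R y e = c * (\<integral>\<^sup>+a. (\<integral>\<^sup>+b. indicator F (glue y (case_nat (- e) a, b)) \<partial>?U) \<partial>?D)" for y e :: "'n site"
  have ind: "(\<lambda>w. indicator F w :: ennreal) \<in> borel_measurable (cylinder_algebra bi_paths)"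
    using F by simp
  have jm: "(\<lambda>p. indicator F (glue y p) :: ennreal) \<in> borel_measurable (?D \<Otimes>\<^sub>M ?U)" for y
    by (rule measurable_compose[OF measurable_glue ind])
  have im: "(\<lambda>a. \<integral>\<^sup>+b. indicator F (glue y (a, b)) \<partial>?U) \<in> borel_measurable ?D" for y
    using U.borel_measurable_nn_integral_fst[OF jm] by simp
  have sF: "{w \<in> bi_paths. time_shift 1 w \<in> F} \<in> sets (cylinder_algebra bi_paths)"
    using measurable_sets[OF measurable_time_shift F, of 1] by (simp add: vimage_def Int_def conj_commute)
  have past: "emeasure (walk_through y) F = (\<Sum>e\<in>?up. R y e)" for y
  proof -
    have "emeasure (walk_through y) F = (\<Sum>e\<in>downward. ennreal (1 / card (downward :: 'n site set)) *
        (\<integral>\<^sup>+a. (\<integral>\<^sup>+b. indicator F (glue y (case_nat e a, b)) \<partial>?U) \<partial>?D))"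
      unfolding emeasure_walk_through[OF F]
      by (rule nn_integral_steps) (simp_all add: finite_upward upward_nonempty im)
    \<comment> \<open>Negation is injective, so the downward jumps are reindexed by the upward ones
      with the same weight \<open>c\<close>.\<close>
    also have "\<dots> = (\<Sum>e\<in>?up. R y e)"
      by (simp add: sum.reindex card_image R_def c_def)
    finally show ?thesis .
  qed
  have future: "emeasure (walk_through x) {w \<in> bi_paths. time_shift 1 w \<in> F} = (\<Sum>e\<in>?up. R (x + e) e)" for x
  proof -
    have g: "indicator {w \<in> bi_paths. time_shift 1 w \<in> F} (glue x (a, case_nat e b)) =
        (indicator F (glue (x + e) (case_nat (- e) a, b)) :: ennreal)"
      if "a \<in> space ?D" "b \<in> space ?U" "e \<in> ?up" for a b e
    proof -
      have "(a, case_nat e b) \<in> space (?D \<Otimes>\<^sub>M ?U)"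
        using that measurable_space[OF measurable_case_nat_step, of e ?up b] by (simp add: space_pair_measure)
      from measurable_space[OF measurable_glue this]
      have "glue x (a, case_nat e b) \<in> bi_paths" by simp
      then show ?thesis by (simp add: indicator_def time_shift_glue_case_nat)
    qed
    have neg: "- e \<in> downward" if "e \<in> ?up" for e using that by simp
    have "emeasure (walk_through x) {w \<in> bi_paths. time_shift 1 w \<in> F} =
        (\<integral>\<^sup>+a. (\<integral>\<^sup>+b. indicator {w \<in> bi_paths. time_shift 1 w \<in> F} (glue x (a, b)) \<partial>?U) \<partial>?D)"
      by (rule emeasure_walk_through[OF sF])
    also have "\<dots> = (\<integral>\<^sup>+a. (\<Sum>e\<in>?up. c *
        (\<integral>\<^sup>+b. indicator F (glue (x + e) (case_nat (- e) a, b)) \<partial>?U)) \<partial>?D)"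
    proof (rule nn_integral_cong)
      fix a assume a: "a \<in> space ?D"
      have "(\<lambda>p. indicator {w \<in> bi_paths. time_shift 1 w \<in> F} (glue x p) :: ennreal) \<in> borel_measurable (?D \<Otimes>\<^sub>M ?U)"
        by (rule measurable_compose[OF measurable_glue borel_measurable_indicator[OF sF]])
      from measurable_compose[OF measurable_Pair1'[OF a] this]
      have "(\<lambda>b. indicator {w \<in> bi_paths. time_shift 1 w \<in> F} (glue x (a, b)) :: ennreal) \<in> borel_measurable ?U" .
      then show "(\<integral>\<^sup>+b. indicator {w \<in> bi_paths. time_shift 1 w \<in> F} (glue x (a, b)) \<partial>?U) =
          (\<Sum>e\<in>?up. c * (\<integral>\<^sup>+b. indicator F (glue (x + e) (case_nat (- e) a, b)) \<partial>?U))"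
        unfolding c_def
        by (subst nn_integral_steps[OF finite_upward upward_nonempty])
          (auto intro!: sum.cong arg_cong2[where f = "(*)"] nn_integral_cong g[OF a])
    qed
    also have "\<dots> = (\<Sum>e\<in>?up. R (x + e) e)"
    proof -
      have "(\<lambda>a. \<integral>\<^sup>+b. indicator F (glue (x + e) (case_nat (- e) a, b)) \<partial>?U) \<in> borel_measurable ?D"
        if "e \<in> ?up" for e
        using measurable_compose[OF measurable_case_nat_step[OF neg[OF that]] im] .
      then show ?thesis
        unfolding R_def by (subst nn_integral_sum) (simp_all add: nn_integral_cmult cong: sum.cong)
    qed
    finally show ?thesis .
  qed
  have bij: "bij (\<lambda>x. x + e)" for e :: "'n site"
    by (rule bij_betwI[of _ _ _ "\<lambda>x. x - e"]) auto
  have "emeasure stationary_walk {w \<in> bi_paths. time_shift 1 w \<in> F} =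
      (\<integral>\<^sup>+x. (\<Sum>e\<in>?up. R (x + e) e) \<partial>count_space UNIV)"
    by (simp add: emeasure_stationary_walk[OF sF] future)
  \<comment> \<open>The sum over jumps is moved outside because the translation of the starting site
    depends on \<open>e\<close>.\<close>
  also have "\<dots> = (\<Sum>e\<in>?up. \<integral>\<^sup>+x. R (x + e) e \<partial>count_space UNIV)"
    by (rule nn_integral_sum) simp
  also have "\<dots> = (\<Sum>e\<in>?up. \<integral>\<^sup>+x. R x e \<partial>count_space UNIV)"
    by (intro sum.cong refl nn_integral_bij_count_space[OF bij])
  also have "\<dots> = (\<integral>\<^sup>+x. (\<Sum>e\<in>?up. R x e) \<partial>count_space UNIV)"
    by (rule nn_integral_sum[symmetric]) simp
  also have "\<dots> = emeasure stationary_walk F"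
    by (simp add: emeasure_stationary_walk[OF F] past)
  finally show ?thesis .
qed

lemma emeasure_stationary_walk_time_shift:
  assumes F: "F \<in> sets (cylinder_algebra bi_paths)"
  shows "emeasure stationary_walk {w \<in> bi_paths. time_shift k w \<in> F} =
    emeasure (stationary_walk :: (int \<Rightarrow> 'n::finite site) measure) F"
proof -
  let ?T = "\<lambda>k. {w \<in> bi_paths. time_shift k w \<in> F}"
  have "?T k \<in> sets (cylinder_algebra bi_paths)" for k
    using measurable_sets[OF measurable_time_shift F, of k] by (simp add: vimage_def Int_def conj_commute)
  \<comment> \<open>The one-step invariance is applied to \<open>?T k\<close> in place of
    \<open>F\<close>, since shifting once more yields \<open>?T (k + 1)\<close>. The resulting
    equality of neighbours can be followed upwards and downwards from \<open>k = 0\<close>.\<close>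
  from emeasure_stationary_walk_time_shift_1[OF this]
  have step: "emeasure stationary_walk (?T (k + 1)) = emeasure stationary_walk (?T k)" for k
    by simp
  show ?thesis
  proof (induction k rule: int_induct[where k = 0])
    case base
    have "?T 0 = F" using sets.sets_into_space[OF F] by auto
    then show ?case by simp
  next
    case (step1 i)
    then show ?case using step[of i] by simp
  next
    case (step2 i)
    then show ?case using step[of "i - 1"] by simp
  qed
qed


section \<open>The measures \<open>Q K\<close> inside the stationary walk\<close>

text \<open>Past and future are driven by independent step sequences, so the preimage of the event
  under \<open>glue y\<close> is a rectangle, empty unless the walk starts at
  \<open>x\<close>.\<close>

lemma emeasure_walk_through_Q_event:
  fixes x y :: "'n::finite site"
  assumes A: "A \<in> sets (cylinder_algebra (half_paths downward))"
    and B: "B \<in> sets (cylinder_algebra (half_paths upward))"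
  shows "emeasure (walk_through y) (Q_event A x B) =
    emeasure (walk_law downward x) A * emeasure (walk_law upward x) B * indicator {x} y"
proof -
  let ?D = "steps (downward :: 'n site set)" and ?U = "steps (upward :: 'n site set)"
  interpret U: prob_space ?U by (rule prob_space_upward)
  have past: "(\<lambda>n. glue y p (- int n)) = walk y (fst p)" for p
    by (auto simp: glue_def walk_def fun_eq_iff)
  have future: "(\<lambda>n. glue y p (int n)) = walk y (snd p)" and start: "glue y p 0 = y" for p
    by (auto simp: glue_def walk_def fun_eq_iff)
  have "glue y p \<in> bi_paths" if "p \<in> space (?D \<Otimes>\<^sub>M ?U)" for p
    using measurable_space[OF measurable_glue that] by simp
  then have pre: "glue y -` Q_event A x B \<inter> space (?D \<Otimes>\<^sub>M ?U) =
      (if y = x then (walk x -` A \<inter> space ?D) \<times> (walk x -` B \<inter> space ?U) else {})"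
    by (auto simp: Q_event_def past future start space_pair_measure)
  have "emeasure (walk_through y) (Q_event A x B) =
      emeasure (?D \<Otimes>\<^sub>M ?U) (glue y -` Q_event A x B \<inter> space (?D \<Otimes>\<^sub>M ?U))"
    unfolding walk_through_def by (rule emeasure_distr[OF measurable_glue Q_event_sets[OF A B]])
  also have "\<dots> = emeasure ?D (walk x -` A \<inter> space ?D) * emeasure ?U (walk x -` B \<inter> space ?U) * indicator {x} y"
    unfolding pre
    using U.emeasure_pair_measure_Times[OF measurable_sets[OF measurable_walk A] measurable_sets[OF measurable_walk B]]
    by simp
  finally show ?thesis
    by (simp add: walk_law_def emeasure_distr[OF measurable_walk] A B)
qed

text \<open>By \<open>is_Q_unique\<close> it suffices to verify the defining properties of
  \<open>Q K\<close>. For a path at \<open>x \<in> K\<close> at time 0, entering \<open>K\<close> at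
  time 0 means that the reversed past never returns to \<open>K\<close>. Restricting to
  \<open>entering_at K 0\<close> therefore replaces \<open>A\<close> by
  \<open>A \<inter> {w. return_time K w = \<infinity>}\<close>, and only the starting site
  \<open>x\<close> contributes.\<close>

lemma Q_eq_density:
  fixes K :: "'n::finite site set"
  assumes K: "finite K"
  shows "Q K = density stationary_walk (indicator (entering_at K 0))"
proof (rule is_Q_unique[OF K is_Q_Q[OF K]])
  let ?M = "density stationary_walk (indicator (entering_at K 0))"
  have e0: "entering_at K 0 \<in> sets stationary_walk"
    by (simp add: entering_at_0_sets)
  have "bi_paths - entering_at K 0 \<in> sets stationary_walk"
    using sets.compl_sets[OF entering_at_0_sets[of K]] by simp
  then have null: "emeasure ?M (bi_paths - entering_at K 0) = 0"
    by (simp add: emeasure_restricted[OF e0])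
  have event: "emeasure ?M (Q_event A x B) =
      emeasure (walk_law downward x) (A \<inter> {w. return_time K w = \<infinity>}) * emeasure (walk_law upward x) B"
    if A: "A \<in> sets (cylinder_algebra (half_paths downward))"
      and B: "B \<in> sets (cylinder_algebra (half_paths upward))" and x: "x \<in> K" for A x B
  proof -
    let ?A = "A \<inter> {w. return_time K w = \<infinity>}"
    let ?c = "emeasure (walk_law downward x) ?A * emeasure (walk_law upward x) B"
    have "?A = A \<inter> {w \<in> half_paths downward. return_time K w = \<infinity>}"
      using sets.sets_into_space[OF A] by auto
    then have A': "?A \<in> sets (cylinder_algebra (half_paths downward))"
      using sets.Int[OF A never_return_sets[of _ K]] by simp
    have "entering_at K 0 \<inter> Q_event A x B = Q_event ?A x B"
      using x by (auto simp: Q_event_def entering_at_0 return_time_eq_infinity)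
    then have "emeasure ?M (Q_event A x B) = emeasure stationary_walk (Q_event ?A x B)"
      using Q_event_sets[OF A B] by (simp add: emeasure_restricted[OF e0])
    also have "\<dots> = (\<integral>\<^sup>+y. ?c * indicator {x} y \<partial>count_space UNIV)"
      by (simp only: emeasure_stationary_walk[OF Q_event_sets[OF A' B]] emeasure_walk_through_Q_event[OF A' B])
    also have "\<dots> = ?c" by (subst nn_integral_cmult_indicator) simp_all
    finally show ?thesis .
  qed
  show "is_Q K ?M" using null event by (auto simp: is_Q_def Q_event_def)
qed


section \<open>Entrance times and classes of paths\<close>

text \<open>An infimum of integers equal to the integer \<open>m\<close> must be attained: otherwise
  every visit happens at time \<open>m + 1\<close> or later, which pushes the infimum above
  \<open>m\<close>. This trades extended reals for a condition on single times.\<close>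

lemma entering_at_iff:
  "w \<in> entering_at K m \<longleftrightarrow> w \<in> bi_paths \<and> w m \<in> K \<and> (\<forall>j<m. w j \<notin> K)"
proof -
  have "entrance_time K w = ereal (real_of_int m) \<longleftrightarrow> w m \<in> K \<and> (\<forall>j<m. w j \<notin> K)" (is "?l \<longleftrightarrow> ?r")
  proof
    assume l: ?l
    have ge: "m \<le> j" if "w j \<in> K" for j
    proof -
      have "entrance_time K w \<le> ereal (real_of_int j)"
        unfolding entrance_time_def by (rule INF_lower) (use that in simp)
      then show ?thesis using l by simp
    qed
    have "w m \<in> K"
    proof (rule ccontr)
      assume "w m \<notin> K"
      then have "m + 1 \<le> j" if "w j \<in> K" for j
        using ge[OF that] that by (cases "j = m") auto
      then have "ereal (real_of_int (m + 1)) \<le> entrance_time K w"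
        unfolding entrance_time_def
        by (intro INF_greatest) (simp only: mem_Collect_eq ereal_less_eq of_int_le_iff)
      then show False using l by simp
    qed
    then show ?r using ge by (meson not_le)
  next
    assume r: ?r
    then have "entrance_time K w \<le> ereal (real_of_int m)"
      unfolding entrance_time_def by (intro INF_lower) simp
    moreover have "ereal (real_of_int m) \<le> entrance_time K w"
      unfolding entrance_time_def using r by (intro INF_greatest) (auto simp: not_less[symmetric])
    ultimately show ?l by (rule antisym)
  qed
  then show ?thesis by (simp add: entering_at_def)
qed

lemma time_shift_in_entering_at_iff: "time_shift k w \<in> entering_at K m \<longleftrightarrow> w \<in> entering_at K (k + m)"
proof -
  have "(\<forall>j<m. w (k + j) \<notin> K) \<longleftrightarrow> (\<forall>j<k + m. w j \<notin> K)"
    by (metis add_less_cancel_left diff_add_cancel add.commute)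
  then show ?thesis by (simp add: entering_at_iff) (simp add: time_shift_def)
qed

lemma disjoint_entering_at: "disjoint_family (entering_at K)"
  by (auto simp: disjoint_family_on_def entering_at_iff) (metis linorder_neqE)

lemma snd_bi_path:
  assumes "w \<in> bi_paths"
  shows "snd (w n) = snd (w 0) + n"
proof -
  have step: "snd (w (i + 1)) = snd (w i) + 1" for i
  proof -
    obtain a where "w (i + 1) - w i = (a, 1)" using assms by (auto simp: bi_paths_def upward_def)
    then have "snd (w (i + 1)) - snd (w i) = 1" by (metis snd_conv snd_diff)
    then show ?thesis by simp
  qed
  show ?thesis
  proof (induction n rule: int_induct[where k = 0])
    case (step2 i)
    then show ?case using step[of "i - 1"] by simp
  qed (simp_all add: step)
qed

text \<open>The last coordinate acts as a clock, so that a path visits \<open>K\<close> only finitely often.\<close>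

lemma entering_eq:
  assumes K: "finite K"
  shows "entering K = {w \<in> bi_paths. \<exists>n. w n \<in> K}"
proof (intro equalityI subsetI)
  fix w assume "w \<in> {w \<in> bi_paths. \<exists>n. w n \<in> K}"
  then have w: "w \<in> bi_paths" and ne: "{n. w n \<in> K} \<noteq> {}" by auto
  \<comment> \<open>The time of a visit can be read off from the height of the visited site, so
    there are at most as many visits to \<open>K\<close> as sites in \<open>K\<close>.\<close>
  have "n \<in> (\<lambda>x. snd x - snd (w 0)) ` K" if "w n \<in> K" for n
    using that snd_bi_path[OF w, of n] by (intro image_eqI[of _ _ "w n"]) simp_all
  then have fin: "finite {n. w n \<in> K}"
    by (intro finite_subset[OF _ finite_imageI[OF K]]) auto
  define m where "m = Min {n. w n \<in> K}"
  have "w m \<in> K" using Min_in[OF fin ne] by (simp add: m_def)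
  moreover have "w j \<notin> K" if "j < m" for j
    using Min_le[OF fin, of j] that by (auto simp: m_def)
  ultimately show "w \<in> entering K"
    using w by (auto simp: entering_def entering_at_iff)
qed (auto simp: entering_def entering_at_iff)

lemma entering_at_sets: "entering_at K m \<in> sets (cylinder_algebra bi_paths)"
proof -
  have "entering_at K m = time_shift m -` entering_at K 0 \<inter> space (cylinder_algebra bi_paths)"
    by (auto simp: time_shift_in_entering_at_iff) (simp add: entering_at_iff)
  then show ?thesis using measurable_sets[OF measurable_time_shift entering_at_0_sets] by metis
qed

lemma entering_sets: "entering K \<in> sets (cylinder_algebra bi_paths)"
  unfolding entering_def by (intro sets.countable_UN) (auto simp: entering_at_sets)

section \<open>Classes as orbits of the time shift\<close>

lemma path_class_eq_range:
  assumes "w \<in> bi_paths"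
  shows "path_class w = range (\<lambda>k. time_shift k w)"
proof -
  have "(w, w') \<in> shift_rel \<longleftrightarrow> w' \<in> range (\<lambda>k. time_shift k w)" for w'
  proof
    assume "(w, w') \<in> shift_rel"
    then obtain k where "\<forall>n. w n = w' (k + n)" unfolding shift_rel_def by blast
    then have "w = time_shift k w'" by (simp add: time_shift_def fun_eq_iff)
    then have "w' = time_shift (- k) w" by simp
    then show "w' \<in> range (\<lambda>k. time_shift k w)" by blast
  next
    assume "w' \<in> range (\<lambda>k. time_shift k w)"
    then obtain k where k: "w' = time_shift k w" by blast
    then have "\<forall>n. w n = w' (- k + n)" by (simp add: time_shift_def)
    moreover have "w' \<in> bi_paths" using assms k by simp
    ultimately show "(w, w') \<in> shift_rel" using assms unfolding shift_rel_def by blast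
  qed
  then show ?thesis by (auto simp: path_class_def)
qed

lemma path_class_time_shift [simp]: "w \<in> bi_paths \<Longrightarrow> path_class (time_shift k w) = path_class w"
proof -
  assume w: "w \<in> bi_paths"
  have "range (\<lambda>l. time_shift (l + k) w) = range (\<lambda>l. time_shift l w)"
  proof (intro equalityI subsetI)
    fix v assume "v \<in> range (\<lambda>l. time_shift l w)"
    then obtain l where "v = time_shift ((l - k) + k) w" by auto
    then show "v \<in> range (\<lambda>l. time_shift (l + k) w)" by blast
  qed blast
  then show ?thesis using w by (simp add: path_class_eq_range)
qed

lemma path_class_eqD:
  assumes "path_class w = path_class w'" "w \<in> bi_paths" "w' \<in> bi_paths"
  obtains k where "w = time_shift k w'"
proof -
  have "w \<in> path_class w" using path_class_eq_range[OF assms(2)] time_shift_0[of w] by (metis rangeI)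
  then show ?thesis using that assms by (auto simp: path_class_eq_range[OF assms(3)])
qed

lemma space_class_algebra [simp]: "space class_algebra = path_classes"
  unfolding class_algebra_def by (rule space_measure_of) auto

lemma path_class_in_path_classes: "w \<in> bi_paths \<Longrightarrow> path_class w \<in> path_classes"
  unfolding path_class_def path_classes_def by (rule quotientI)

lemma measurable_path_class: "path_class \<in> measurable (cylinder_algebra bi_paths) class_algebra"
  by (rule measurableI) (simp_all add: path_class_in_path_classes class_algebra_sets)

text \<open>A time shift only translates the entrance time, so \<open>entering K\<close> is a union
  of full shift orbits and is recovered from its image.\<close>

lemma path_class_vimage_class_entering: "path_class -` class_entering K \<inter> bi_paths = entering K"
proof (intro equalityI subsetI)
  fix w assume w: "w \<in> path_class -` class_entering K \<inter> bi_paths"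
  then obtain w' m where "path_class w = path_class w'" "w' \<in> entering_at K m"
    by (auto simp: class_entering_def entering_def)
  moreover from this have "w' \<in> bi_paths" by (simp add: entering_at_iff)
  ultimately obtain k where "w = time_shift k w'" "w' \<in> entering_at K m"
    using w path_class_eqD by (metis IntD2)
  then have "w \<in> entering_at K (m - k)" by (simp add: time_shift_in_entering_at_iff)
  then show "w \<in> entering K" by (auto simp: entering_def)
qed (auto simp: class_entering_def entering_def entering_at_iff)

lemma class_entering_sets: "class_entering K \<in> sets class_algebra"
  unfolding class_algebra_sets
  by (auto simp: path_class_vimage_class_entering entering_sets)
    (auto simp: class_entering_def entering_def entering_at_iff path_class_in_path_classes)


section \<open>Existence and uniqueness\<close>

text \<open>
  Every class has exactly one representative at height \<open>0\<close> at time \<open>0\<close>. Choosing it, rather than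
  the representative entering \<open>K\<close> at time \<open>0\<close>, gives a measure that does not depend on \<open>K\<close>.
\<close>

definition class_measure :: "(int \<Rightarrow> 'n::finite site) set measure" where
  "class_measure =
     distr (density stationary_walk (indicator {w \<in> bi_paths. snd (w 0) \<in> {0}})) class_algebra path_class"

lemma sets_class_measure [simp]: "sets class_measure = sets class_algebra"
  by (simp add: class_measure_def)

lemma height_sets: "{w \<in> bi_paths. snd (w 0) \<in> A} \<in> sets (cylinder_algebra bi_paths)"
  using cylinder_in_sets[of bi_paths 0 "snd -` A"] by simp

text \<open>Each shift orbit inside \<open>entering K \<inter> F\<close> has exactly one path at
  height 0 at time 0 and exactly one path entering \<open>K\<close> at time 0. Passing from one
  choice to the other shifts by the entrance time, which is constant on each of countably many
  pieces, so shift invariance of the measure applies piece by piece.\<close>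

lemma stationary_walk_transport:
  fixes F :: "(int \<Rightarrow> 'n::finite site) set"
  assumes F: "F \<in> sets (cylinder_algebra bi_paths)"
    and inv: "\<And>k w. w \<in> bi_paths \<Longrightarrow> time_shift k w \<in> F \<longleftrightarrow> w \<in> F"
  shows "emeasure stationary_walk ({w \<in> bi_paths. snd (w 0) \<in> {0}} \<inter> (entering K \<inter> F)) =
    emeasure stationary_walk (entering_at K 0 \<inter> F)"
proof -
  let ?L = "\<lambda>m :: int. {w \<in> bi_paths. snd (w 0) \<in> {m}} :: (int \<Rightarrow> 'n site) set"
  let ?S = "stationary_walk :: (int \<Rightarrow> 'n site) measure"
  have sets: "?L l \<inter> (entering_at K m \<inter> F) \<in> sets (cylinder_algebra bi_paths)" for l m
    by (intro sets.Int height_sets entering_at_sets F)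
  have "?L 0 \<inter> (entering K \<inter> F) = (\<Union>m. ?L 0 \<inter> (entering_at K m \<inter> F))"
    by (auto simp: entering_def)
  moreover have "disjoint_family (\<lambda>m. ?L 0 \<inter> (entering_at K m \<inter> F))"
    using disjoint_entering_at[of K] by (auto simp: disjoint_family_on_def)
  ultimately have "emeasure ?S (?L 0 \<inter> (entering K \<inter> F)) =
      (\<integral>\<^sup>+m. emeasure ?S (?L 0 \<inter> (entering_at K m \<inter> F)) \<partial>count_space UNIV)"
    using sets by (simp only:) (intro emeasure_UN_countable, simp_all)
  also have "\<dots> = (\<integral>\<^sup>+m. emeasure ?S (?L m \<inter> (entering_at K 0 \<inter> F)) \<partial>count_space UNIV)"
  proof (rule nn_integral_cong)
    fix m
    have h: "snd (time_shift m w 0) = snd (w 0) + m" if "w \<in> bi_paths" for w :: "int \<Rightarrow> 'n site"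
      using snd_bi_path[OF that, of m] by (simp add: time_shift_def)
    \<comment> \<open>Height grows by one per unit of time, so the shift by \<open>m\<close> turns
      height 0 into height \<open>m\<close> while it turns entrance time \<open>m\<close> into 0;
      \<open>F\<close> is unchanged by \<open>inv\<close>.\<close>
    have "?L 0 \<inter> (entering_at K m \<inter> F) = {w \<in> bi_paths. time_shift m w \<in> ?L m \<inter> (entering_at K 0 \<inter> F)}"
      by (auto simp: h inv time_shift_in_entering_at_iff)
    then show "emeasure ?S (?L 0 \<inter> (entering_at K m \<inter> F)) = emeasure ?S (?L m \<inter> (entering_at K 0 \<inter> F))"
      using emeasure_stationary_walk_time_shift[OF sets[of m 0], of m] by simp
  qed
  also have "\<dots> = emeasure ?S (\<Union>m. ?L m \<inter> (entering_at K 0 \<inter> F))"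
    using sets by (intro emeasure_UN_countable[symmetric]) (auto simp: disjoint_family_on_def)
  \<comment> \<open>Every path has some integer height at time 0, so the levels \<open>?L m\<close>
    together impose no condition.\<close>
  also have "(\<Union>m. ?L m \<inter> (entering_at K 0 \<inter> F)) = entering_at K 0 \<inter> F"
    by (auto simp: entering_at_iff)
  finally show ?thesis .
qed

text \<open>Pulled back to paths, an event \<open>E\<close> on classes becomes a shift-invariant
  event. The two sides then differ only in the representative chosen from each orbit, which is what
  \<open>stationary_walk_transport\<close> exchanges.\<close>

lemma class_measure_restricted:
  fixes K :: "'n::finite site set"
  assumes K: "finite K"
  shows "density class_measure (indicator (class_entering K)) = distr (Q K) class_algebra path_class"
proof (rule measure_eqI)
  let ?L = "{w \<in> bi_paths. snd (w 0) \<in> {0}} :: (int \<Rightarrow> 'n site) set"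
  let ?C = "class_entering K"
  show "sets (density class_measure (indicator ?C)) = sets (distr (Q K) class_algebra path_class)"
    by (simp add: class_measure_def)
  fix E assume "E \<in> sets (density class_measure (indicator ?C))"
  then have E: "E \<in> sets class_algebra" by (simp add: class_measure_def)
  let ?F = "path_class -` E \<inter> bi_paths"
  have F: "?F \<in> sets (cylinder_algebra bi_paths)"
    using E by (simp add: class_algebra_sets)
  have pc: "path_class \<in> measurable (density stationary_walk f) class_algebra" for f :: "(int \<Rightarrow> 'n site) \<Rightarrow> ennreal"
    using measurable_path_class by (simp cong: measurable_cong_sets)
  have "emeasure (density class_measure (indicator ?C)) E = emeasure class_measure (?C \<inter> E)"
    by (rule emeasure_restricted) (simp_all add: class_measure_def class_entering_sets E)
  also have "\<dots> = emeasure (density stationary_walk (indicator ?L)) (path_class -` (?C \<inter> E) \<inter> bi_paths)"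
    unfolding class_measure_def
    using emeasure_distr[OF pc sets.Int[OF class_entering_sets E]] by simp
  also have "path_class -` (?C \<inter> E) \<inter> bi_paths = entering K \<inter> ?F"
    using path_class_vimage_class_entering[of K] by auto
  also have "emeasure (density stationary_walk (indicator ?L)) \<dots> =
      emeasure stationary_walk (?L \<inter> (entering K \<inter> ?F))"
    by (rule emeasure_restricted)
      (simp_all only: sets_stationary_walk height_sets sets.Int[OF entering_sets F])
  also have "\<dots> = emeasure stationary_walk (entering_at K 0 \<inter> ?F)"
    \<comment> \<open>The invariance hypothesis holds because \<open>path_class\<close> is constant
      along time shifts.\<close>
    by (rule stationary_walk_transport[OF F]) simp
  also have "\<dots> = emeasure (Q K) ?F"
    unfolding Q_eq_density[OF K]
    by (rule emeasure_restricted[symmetric]) (simp_all only: sets_stationary_walk entering_at_sets F)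
  also have "\<dots> = emeasure (distr (Q K) class_algebra path_class) E"
    unfolding Q_eq_density[OF K] using emeasure_distr[OF pc E] by simp
  finally show "emeasure (density class_measure (indicator ?C)) E =
      emeasure (distr (Q K) class_algebra path_class) E" .
qed

section \<open>Uniqueness by exhaustion with finite sets of sites\<close>

lemma incseq_class_entering:
  fixes K :: "nat \<Rightarrow> 'n::finite site set"
  assumes "\<And>n. finite (K n)" "incseq K"
  shows "incseq (\<lambda>n. class_entering (K n))"
  using assms by (auto simp: incseq_def class_entering_def entering_eq) blast

text \<open>Every path occupies some site, hence visits some \<open>K n\<close>; finiteness of
  \<open>K n\<close> turns the visit into a first one through \<open>entering_eq\<close>.\<close>

lemma UN_class_entering:
  fixes K :: "nat \<Rightarrow> 'n::finite site set"
  assumes "\<And>n. finite (K n)" "(\<Union>n. K n) = UNIV"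
  shows "(\<Union>n. class_entering (K n)) = path_classes"
proof -
  have "(\<Union>n. entering (K n)) = {w \<in> bi_paths. \<exists>i. w i \<in> (\<Union>n. K n)}"
    using assms(1) by (auto simp: entering_eq)
  then have "(\<Union>n. entering (K n)) = bi_paths" by (simp add: assms(2))
  then have "(\<Union>n. class_entering (K n)) = path_class ` bi_paths"
    by (simp add: class_entering_def flip: image_UN)
  also have "\<dots> = path_classes"
    by (auto simp: path_classes_def path_class_def quotient_def)
  finally show ?thesis .
qed

text \<open>Continuity from below along the exhaustion recovers the mass of any event from its
  restrictions to the sets \<open>class_entering (K n)\<close>, whether these masses are finite or
  not.\<close>

lemma class_measure_unique:
  fixes M N :: "(int \<Rightarrow> 'n::finite site) set measure"
  assumes M: "sets M = sets class_algebra" and N: "sets N = sets class_algebra"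
    and eq: "\<And>K :: 'n site set. finite K \<Longrightarrow>
      density M (indicator (class_entering K)) = density N (indicator (class_entering K))"
  shows "M = N"
proof (rule measure_eqI)
  show "sets M = sets N" using M N by simp
  fix E assume "E \<in> sets M"
  then have E: "E \<in> sets class_algebra" using M by simp
  \<comment> \<open>\<open>K n\<close> collects the first \<open>n + 1\<close> entries of an
    enumeration of the countable lattice; a site \<open>x\<close> appears by index
    \<open>to_nat x\<close>.\<close>
  define K :: "nat \<Rightarrow> 'n site set" where "K n = from_nat ` {..n}" for n
  have K: "finite (K n)" "incseq K" for n by (auto simp: K_def incseq_def)
  have "x \<in> K (to_nat x)" for x
    unfolding K_def by (rule image_eqI[of _ _ "to_nat x"]) simp_all
  then have cover: "(\<Union>n. K n) = UNIV" by blast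
  have sup: "emeasure L E = (SUP n. emeasure (density L (indicator (class_entering (K n)))) E)"
    if L: "sets L = sets class_algebra" for L
  proof -
    have "E \<subseteq> path_classes" using sets.sets_into_space[OF E] by simp
    then have "E = (\<Union>n. class_entering (K n) \<inter> E)"
      using UN_class_entering[OF K(1) cover] by blast
    moreover have "incseq (\<lambda>n. class_entering (K n) \<inter> E)"
      using incseq_class_entering[of K, OF K] by (auto simp: incseq_def)
    moreover have "range (\<lambda>n. class_entering (K n) \<inter> E) \<subseteq> sets L"
      using E class_entering_sets L by auto
    ultimately have "emeasure L E = (SUP n. emeasure L (class_entering (K n) \<inter> E))"
      using SUP_emeasure_incseq by metis
    then show ?thesis
      by (simp add: emeasure_restricted L class_entering_sets E)
  qed
  show "emeasure M E = emeasure N E"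
    by (simp only: sup[OF M] sup[OF N] eq[OF K(1)])
qed

theorem theorem2:
  assumes "CARD('n::finite) + 1 \<ge> 3"
  shows "\<exists>!\<nu> :: (int \<Rightarrow> 'n site) set measure.
           sets \<nu> = sets class_algebra \<and>
           (\<forall>K :: 'n site set. finite K \<longrightarrow>
              density \<nu> (indicator (class_entering K)) = distr (Q K) class_algebra path_class)"
proof (rule ex1I[of _ class_measure])
  show "sets (class_measure :: (int \<Rightarrow> 'n site) set measure) = sets class_algebra \<and>
    (\<forall>K :: 'n site set. finite K \<longrightarrow>
       density class_measure (indicator (class_entering K)) = distr (Q K) class_algebra path_class)"
    using sets_class_measure class_measure_restricted by blast
next
  fix \<nu> :: "(int \<Rightarrow> 'n site) set measure"
  assume \<nu>: "sets \<nu> = sets class_algebra \<and>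
    (\<forall>K :: 'n site set. finite K \<longrightarrow>
       density \<nu> (indicator (class_entering K)) = distr (Q K) class_algebra path_class)"
  show "\<nu> = class_measure"
  proof (rule class_measure_unique)
    fix K :: "'n site set" assume "finite K"
    with \<nu> show "density \<nu> (indicator (class_entering K)) = density class_measure (indicator (class_entering K))"
      by (metis class_measure_restricted)
  qed (use \<nu> in auto)
qed

end
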